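(* Let $\mathcal{X}$ be a complete separable metric space equipped with its Borel sigma-field. Let $\mathcal{F}$ be a countable family of Borel measurable functions $f : \mathcal{X} \to \mathbb{R}$ with envelope $F$. If $\mathcal{F}$ is a VC-major class, then for every stationary ergodic process $\mathbf{X} = X_1, X_2, \ldots$ with values in $\mathcal{X}$ such that $E F(X)$ is finite, $$\sup_{f \in \mathcal{F}} \left| \frac{1}{m} \sum_{i=1}^m f(X_i) - E f(X) \right| \to 0 \quad \text{with probability one as } m \to \infty.$$
   Context: $X$ denotes a random variable with the same distribution as $X_1$ (independent of $\mathbf{X}$). A stationary process is ergodic if its invariant sigma-field is trivial. A measurable function $F : \mathcal{X} \to [0,\infty)$ is an envelope for $\mathcal{F}$ if $|f(x)| \leq F(x)$ for each $x \in \mathcal{X}$ and $f \in \mathcal{F}$. VC dimension: for a collection $\mathcal{C}$ of subsets of $\mathcal{X}$ and a finite set $D \subseteq \mathcal{X}$, let $S(D : \mathcal{C}) = |\{ C \cap D : C \in \mathcal{C} \}|$. The VC dimension $\dim(\mathcal{C})$ is the largest integer $k \geq 1$ such that $S(D : \mathcal{C}) = 2^k$ for some $k$-element subset $D$ of $\mathcal{X}$ (taken to be $0$ if no such $k$ exists); if for every $k \geq 1$ there is a $k$-element set $D$ with $S(D : \mathcal{C}) = 2^k$, then $\dim(\mathcal{C}) = +\infty$. VC-major class: for $f : \mathcal{X} \to \mathbb{R}$ and $\alpha \in \mathbb{R}$ let $L_f(\alpha) = \{ x : f(x) \leq \alpha \}$. The family $\mathcal{F}$ is a VC-major class if $\sup_{\alpha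 \in \mathbb{R}} \dim( \{ L_f(\alpha) : f \in \mathcal{F} \} )$ is finite. *)

theory Defs
  imports "HOL-Probability.Probability"
begin

section \<open>VC dimension and VC-major classes\<close>

definition trace_count :: "'a set \<Rightarrow> 'a set set \<Rightarrow> nat" where
  "trace_count D \<C> = card ((\<lambda>C. C \<inter> D) ` \<C>)"

definition shatters_card :: "'a set set \<Rightarrow> nat \<Rightarrow> bool" where
  "shatters_card \<C> k \<longleftrightarrow> (\<exists>D. finite D \<and> card D = k \<and> trace_count D \<C> = 2 ^ k)"

text \<open>The supremum in \<^typ>\<open>enat\<close> is the largest such \<open>k\<close> if there is one, \<open>0\<close> if there is no
  such \<open>k\<close>, and \<open>\<infinity>\<close> if the \<open>k\<close> are unbounded; the last case means that every \<open>k \<ge> 1\<close>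
  occurs, as \<open>vc_dim_eq_infinity_iff\<close> shows.\<close>

definition vc_dim :: "'a set set \<Rightarrow> enat" where
  "vc_dim \<C> = Sup (enat ` {k. k \<ge> 1 \<and> shatters_card \<C> k})"

lemma trace_count_eq_iff:
  assumes "finite D"
  shows "trace_count D \<C> = 2 ^ card D \<longleftrightarrow> (\<lambda>C. C \<inter> D) ` \<C> = Pow D"
proof
  assume "trace_count D \<C> = 2 ^ card D"
  then show "(\<lambda>C. C \<inter> D) ` \<C> = Pow D"
    using assms by (intro card_subset_eq) (auto simp: trace_count_def card_Pow)
qed (use assms in \<open>simp add: trace_count_def card_Pow\<close>)

lemma shatters_card_mono:
  assumes "shatters_card \<C> k" "j \<le> k"
  shows "shatters_card \<C> j"
proof -
  obtain D where D: "finite D" "card D = k" "(\<lambda>C. C \<inter> D) ` \<C> = Pow D"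
    using assms(1) by (auto simp: shatters_card_def trace_count_eq_iff)
  obtain E where E: "E \<subseteq> D" "card E = j" "finite E"
    using obtain_subset_with_card_n[of j D] assms(2) D(2) by blast
  have "(\<lambda>C. C \<inter> E) ` \<C> = (\<lambda>B. B \<inter> E) ` (\<lambda>C. C \<inter> D) ` \<C>"
    using E(1) by (auto simp: image_image Int_assoc Int_absorb1)
  also have "\<dots> = Pow E"
    unfolding D(3) using E(1) by (auto intro!: image_eqI)
  finally show ?thesis
    using E trace_count_eq_iff[of E \<C>] by (auto simp: shatters_card_def)
qed

lemma vc_dim_eq_infinity_iff: "vc_dim \<C> = \<infinity> \<longleftrightarrow> (\<forall>k\<ge>1. shatters_card \<C> k)"
proof
  assume inf: "vc_dim \<C> = \<infinity>"
  show "\<forall>k\<ge>1. shatters_card \<C> k"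
  proof (intro allI impI)
    fix k :: nat
    have "enat k < vc_dim \<C>" by (simp add: inf)
    then obtain j where "shatters_card \<C> j" "k < j"
      by (auto simp: vc_dim_def less_Sup_iff)
    then show "shatters_card \<C> k" by (auto intro: shatters_card_mono)
  qed
next
  assume all: "\<forall>k\<ge>1. shatters_card \<C> k"
  have "enat n \<le> vc_dim \<C>" for n
  proof -
    have "enat n \<le> enat (Suc n)" by simp
    also have "\<dots> \<le> vc_dim \<C>"
      unfolding vc_dim_def using all by (intro Sup_upper imageI) auto
    finally show ?thesis .
  qed
  then show "vc_dim \<C> = \<infinity>"
    by (metis enat_ord_simps(1) not_enat_eq not_less_eq_eq order_refl)
qed

definition sublevel :: "('a \<Rightarrow> real) \<Rightarrow> real \<Rightarrow> 'a set" where
  "sublevel f \<alpha> = {x. f x \<le> \<alpha>}"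

definition vc_major :: "('a \<Rightarrow> real) set \<Rightarrow> bool" where
  "vc_major \<F> \<longleftrightarrow> (SUP \<alpha>. vc_dim ((\<lambda>f. sublevel f \<alpha>) ` \<F>)) < \<infinity>"

definition is_envelope :: "('a::topological_space \<Rightarrow> real) \<Rightarrow> ('a \<Rightarrow> real) set \<Rightarrow> bool" where
  "is_envelope F \<F> \<longleftrightarrow>
     F \<in> borel_measurable borel \<and> (\<forall>x. 0 \<le> F x) \<and> (\<forall>f\<in>\<F>. \<forall>x. \<bar>f x\<bar> \<le> F x)"

section \<open>Stationary ergodic processes\<close>

text \<open>A process \<open>X\<^sub>1, X\<^sub>2, \<dots>\<close> is indexed from \<open>0\<close>: the function value \<open>X i\<close> is the variable
  \<open>X\<^sub>i\<^sub>+\<^sub>1\<close>. There is no additional coordinate before the first one.\<close>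

abbreviation seq_space :: "(nat \<Rightarrow> 'a::topological_space) measure" where
  "seq_space \<equiv> \<Pi>\<^sub>M i\<in>(UNIV :: nat set). borel"

definition random_process :: "'w measure \<Rightarrow> (nat \<Rightarrow> 'w \<Rightarrow> 'a::topological_space) \<Rightarrow> bool" where
  "random_process M X \<longleftrightarrow> prob_space M \<and> (\<forall>i. X i \<in> borel_measurable M)"

definition stationary :: "'w measure \<Rightarrow> (nat \<Rightarrow> 'w \<Rightarrow> 'a::topological_space) \<Rightarrow> bool" where
  "stationary M X \<longleftrightarrow>
     (\<forall>k. distr M seq_space (\<lambda>\<omega> i. X (i + k) \<omega>) = distr M seq_space (\<lambda>\<omega> i. X i \<omega>))"

definition shift :: "(nat \<Rightarrow> 'a) \<Rightarrow> nat \<Rightarrow> 'a" where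
  "shift x = (\<lambda>i. x (Suc i))"

definition shift_invariant_sets :: "(nat \<Rightarrow> 'a::topological_space) set set" where
  "shift_invariant_sets = {A \<in> sets seq_space. shift -` A = A}"

text \<open>The invariant sigma-field of the process, pulled back from sequence space to the
  probability space.\<close>

definition invariant_events :: "'w measure \<Rightarrow> (nat \<Rightarrow> 'w \<Rightarrow> 'a::topological_space) \<Rightarrow> 'w set set" where
  "invariant_events M X = (\<lambda>A. {\<omega> \<in> space M. (\<lambda>i. X i \<omega>) \<in> A}) ` shift_invariant_sets"

definition ergodic :: "'w measure \<Rightarrow> (nat \<Rightarrow> 'w \<Rightarrow> 'a::topological_space) \<Rightarrow> bool" where
  "ergodic M X \<longleftrightarrow> (\<forall>B\<in>invariant_events M X. measure M B = 0 \<or> measure M B = 1)"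

end

theory Submission
  imports Defs
begin

text \<open>
  A family \<open>\<C>\<close> of measurable sets of finite VC dimension has, for each \<open>\<epsilon> > 0\<close>, a finite cover by
  brackets \<open>A \<subseteq> C \<subseteq> B\<close> (up to null sets) with \<open>\<mu> (B - A) < \<epsilon>\<close>. Otherwise there is an ultrafilter \<open>U\<close> on
  \<open>\<C>\<close> no member of which lies in one such bracket. Let \<open>H\<close> be the essential union of the measurable
  sets that \<open>U\<close>-most \<open>C\<close> contain or that \<open>U\<close>-most \<open>C\<close> avoid. If the complement \<open>K\<close> of \<open>H\<close> were null,
  \<open>U\<close>-most \<open>C\<close> would lie in one bracket. Hence \<open>\<mu> K > 0\<close>, and \<open>U\<close>-most \<open>C\<close> split any given subset of \<open>K\<close>
  of positive measure. Choosing sets one after the other gives arbitrarily long Boolean independent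
  sequences in \<open>\<C>\<close>, and hence shattered sets of every size.

  Brackets and the ergodic theorem (proved by Garsia's argument) give uniform convergence over the
  sublevel sets \<open>{f \<le> \<alpha>}\<close> for each \<open>\<alpha>\<close>, and \<open>f\<close> is approximated by averages of finitely many
  indicators of such sets, uniformly up to a term controlled by the tail of the envelope.
\<close>

section \<open>Brackets for families of finite VC dimension\<close>

text \<open>A finer filter is a smaller element of the order, so Zorn's lemma is applied to
  \<open>\<ge>\<close> and yields a minimal proper filter below \<open>J\<close>. Minimality makes
  it an ultrafilter.\<close>

lemma ultrafilter_below:
  fixes J :: "'a filter"
  assumes "J \<noteq> bot"
  obtains U where "U \<le> J" "U \<noteq> bot"
    "\<And>P. eventually P U \<or> eventually (\<lambda>x. \<not> P x) U"
proof -
  let ?A = "{U. U \<le> J \<and> U \<noteq> bot}"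
  have "\<exists>U\<in>?A. \<forall>V\<in>?A. U \<ge> V \<longrightarrow> V = U"
  proof (rule predicate_Zorn)
    show "partial_order_on ?A (relation_of (\<ge>) ?A)"
      by (auto simp: partial_order_on_def preorder_on_def refl_on_def trans_def antisym_def
          relation_of_def)
  next
    fix C assume C: "C \<in> Chains (relation_of (\<ge>) ?A)"
    show "\<exists>U\<in>?A. \<forall>V\<in>C. V \<ge> U"
    proof (cases "C = {}")
      case True
      then show ?thesis using assms by auto
    next
      case False
      have sub: "V \<le> J" "V \<noteq> bot" if "V \<in> C" for V
        using C that by (auto simp: Chains_def relation_of_def)
      have tot: "V \<le> W \<or> W \<le> V" if "V \<in> C" "W \<in> C" for V W
        using C that by (auto simp: Chains_def relation_of_def)
      \<comment> \<open>A nonempty chain is directed, so its infimum contains only the properties of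
        its members and stays proper.\<close>
      have "eventually P (Inf C) \<longleftrightarrow> (\<exists>V\<in>C. eventually P V)" for P
        using False by (intro eventually_Inf_base) (metis tot inf.absorb1 inf.absorb2 order_refl)+
      then have "Inf C \<noteq> bot"
        using sub(2) by (auto simp: trivial_limit_def)
      moreover have "Inf C \<le> J"
        using False sub(1) by (meson Inf_lower2 ex_in_conv)
      ultimately show ?thesis by (auto intro: Inf_lower)
    qed
  qed
  then obtain U where U: "U \<le> J" "U \<noteq> bot" and
    min: "\<And>V. V \<le> J \<Longrightarrow> V \<noteq> bot \<Longrightarrow> V \<le> U \<Longrightarrow> V = U"
    by auto
  \<comment> \<open>Adjoining \<open>P\<close> to \<open>U\<close> gives either the improper filter,
    and then \<open>\<not> P\<close> already holds eventually, or a proper filter below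
    \<open>U\<close>, which is \<open>U\<close> itself by minimality.\<close>
  have "eventually P U \<or> eventually (\<lambda>x. \<not> P x) U" for P
  proof (cases "inf U (principal {x. P x}) = bot")
    case True
    then show ?thesis
      by (simp add: trivial_limit_def eventually_inf_principal)
  next
    case False
    then have "inf U (principal {x. P x}) = U"
      using U by (intro min) (auto intro: le_infI1)
    moreover have "eventually P (inf U (principal {x. P x}))"
      by (simp add: eventually_inf_principal)
    ultimately show ?thesis by simp
  qed
  with U that show thesis by blast
qed

text \<open>An exhaustion argument: finite unions of members whose measures approach the supremum
  \<open>s\<close> increase to \<open>H\<close>, which has measure \<open>s\<close>. As a countable
  union, \<open>H\<close> may lie outside \<open>\<E>\<close>, hence the approximation of
  \<open>H\<close> by members in the last conclusion.\<close>

lemma (in finite_measure) union_closed_essential_sup: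
  assumes "\<E> \<subseteq> sets M" "\<E> \<noteq> {}"
    and union: "\<And>A B. A \<in> \<E> \<Longrightarrow> B \<in> \<E> \<Longrightarrow> A \<union> B \<in> \<E>"
  obtains H where "H \<in> sets M" "\<And>E. E \<in> \<E> \<Longrightarrow> measure M (E - H) = 0"
    "\<And>e. e > 0 \<Longrightarrow> \<exists>E\<in>\<E>. measure M (H - E) < e"
proof -
  define s where "s = (SUP E\<in>\<E>. measure M E)"
  have bdd: "bdd_above (measure M ` \<E>)"
    by (auto simp: bdd_above_def intro: bounded_measure)
  have le_s: "measure M E \<le> s" if "E \<in> \<E>" for E
    unfolding s_def using that bdd by (rule cSUP_upper)
  have "\<exists>E\<in>\<E>. s - 1 / Suc n < measure M E" for n
    using less_cSUP_iff[OF assms(2) bdd, of "s - 1 / Suc n"] by (simp add: s_def)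
  then obtain G where G: "\<And>n. G n \<in> \<E>" "\<And>n. s - 1 / Suc n < measure M (G n)"
    by metis
  define P where "P n = (\<Union>i\<le>n. G i)" for n
  have P: "P n \<in> \<E>" for n
  proof (induction n)
    case (Suc n)
    have "P (Suc n) = P n \<union> G (Suc n)" by (auto simp: P_def atMost_Suc)
    then show ?case using Suc G(1) union by simp
  qed (simp add: P_def G)
  have Pm: "P n \<in> sets M" for n using P assms(1) by auto
  have inc: "incseq P" by (force simp: P_def incseq_def)
  define H where "H = (\<Union>n. P n)"
  have Hm: "H \<in> sets M" using Pm by (auto simp: H_def)
  have H_ge: "s - 1 / Suc n < measure M (P n)" for n
  proof -
    have "measure M (G n) \<le> measure M (P n)"
      by (rule finite_measure_mono[OF _ Pm]) (auto simp: P_def)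
    then show ?thesis using G(2)[of n] by linarith
  qed
  have lim: "(\<lambda>n. measure M (P n)) \<longlonglongrightarrow> measure M H"
    unfolding H_def using Pm inc by (intro finite_Lim_measure_incseq) auto
  have "(\<lambda>n. s - 1 / Suc n) \<longlonglongrightarrow> s - 0"
    by (intro tendsto_intros LIMSEQ_Suc[OF lim_1_over_n])
  then have sH: "s \<le> measure M H"
    using lim H_ge by (intro LIMSEQ_le[of "\<lambda>n. s - 1 / Suc n" s]) (auto intro: less_imp_le)
  have Hs: "measure M H \<le> s"
    using lim le_s[OF P] by (intro LIMSEQ_le_const2[OF lim]) auto
  show thesis
  proof (rule that[OF Hm])
    fix E assume E: "E \<in> \<E>"
    then have Em: "E \<in> sets M" using assms by auto
    have "(\<lambda>n. measure M (E \<union> P n)) \<longlonglongrightarrow> measure M (\<Union>n. E \<union> P n)"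
      using Pm Em inc by (intro finite_Lim_measure_incseq) (auto simp: incseq_def)
    moreover have "(\<Union>n. E \<union> P n) = E \<union> H" by (auto simp: H_def)
    ultimately have "measure M (E \<union> H) \<le> s"
      using le_s[OF union[OF E P]] by (intro LIMSEQ_le_const2) auto
    moreover have "measure M (H \<union> (E - H)) = measure M H + measure M (E - H)"
      using Hm Em by (intro finite_measure_Union) auto
    moreover have "H \<union> (E - H) = E \<union> H" by blast
    ultimately show "measure M (E - H) = 0"
      using sH measure_nonneg[of M "E - H"] by (metis add_le_same_cancel1 order_antisym order_trans)
  next
    fix e :: real assume "e > 0"
    then obtain n where n: "1 / Suc n < e" using nat_approx_posE by metis
    have "measure M (H - P n) = measure M H - measure M (P n)"
      by (rule finite_measure_Diff[OF Hm Pm]) (auto simp: H_def)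
    then have "measure M (H - P n) < e" using n Hs H_ge[of n] by simp
    then show "\<exists>E\<in>\<E>. measure M (H - E) < e" using P by blast
  qed
qed

section \<open>Boolean independence and the bracket dichotomy\<close>

definition independent_cell :: "(nat \<Rightarrow> 'a set) \<Rightarrow> nat \<Rightarrow> nat set \<Rightarrow> 'a set" where
  "independent_cell C n T = {x. \<forall>i<n. x \<in> C i \<longleftrightarrow> i \<in> T}"

text \<open>Index the sets by the subsets of \<open>{..<k}\<close>; then the \<open>j\<close>-th point is taken from the cell inside
  exactly those sets whose index contains \<open>j\<close>.\<close>

lemma shatters_card_if_independent:
  assumes "\<And>i. i < (2::nat) ^ k \<Longrightarrow> C i \<in> \<C>"
    and ne: "\<And>T. T \<subseteq> {..<2 ^ k} \<Longrightarrow> independent_cell C (2 ^ k) T \<noteq> {}"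
  shows "shatters_card \<C> k"
proof -
  obtain e where e: "bij_betw e {..<(2::nat) ^ k} (Pow {..<k})"
    using finite_same_card_bij[of "{..<(2::nat) ^ k}" "Pow {..<k}"] by (auto simp: card_Pow)
  have "\<exists>x. \<forall>i<2 ^ k. x \<in> C i \<longleftrightarrow> j \<in> e i" for j
    using ne[of "{i. i < 2 ^ k \<and> j \<in> e i}"] by (auto simp: independent_cell_def)
  then obtain x where x: "\<And>j i. i < 2 ^ k \<Longrightarrow> x j \<in> C i \<longleftrightarrow> j \<in> e i" by metis
  have ex: "\<exists>i<2 ^ k. e i = B" if "B \<subseteq> {..<k}" for B
    using e that unfolding bij_betw_def by (metis PowI imageE lessThan_iff)
  have inj: "inj_on x {..<k}"
  proof
    fix a b assume ab: "a \<in> {..<k}" "b \<in> {..<k}" "x a = x b"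
    \<comment> \<open>The set indexed by the singleton \<open>{a}\<close> contains
      \<open>x a\<close> but no \<open>x b\<close> with \<open>b \<noteq> a\<close>.\<close>
    obtain i where "i < 2 ^ k" "e i = {a}" using ex[of "{a}"] ab by auto
    then show "a = b" using x[of i a] x[of i b] ab(3) by (metis insertI1 singletonD)
  qed
  have "Pow (x ` {..<k}) \<subseteq> (\<lambda>C. C \<inter> x ` {..<k}) ` \<C>"
  proof
    fix D assume "D \<in> Pow (x ` {..<k})"
    then obtain B where B: "B \<subseteq> {..<k}" "D = x ` B" by (auto simp: subset_image_iff)
    obtain i where i: "i < 2 ^ k" "e i = B" using ex[OF B(1)] by auto
    have "D = C i \<inter> x ` {..<k}" using B i x[OF i(1)] by auto
    then show "D \<in> (\<lambda>C. C \<inter> x ` {..<k}) ` \<C>" using assms(1)[OF i(1)] by auto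
  qed
  then have "(\<lambda>C. C \<inter> x ` {..<k}) ` \<C> = Pow (x ` {..<k})" by auto
  then have "trace_count (x ` {..<k}) \<C> = 2 ^ card (x ` {..<k})"
    by (subst trace_count_eq_iff) auto
  then show ?thesis
    unfolding shatters_card_def using card_image[OF inj] by (intro exI[of _ "x ` {..<k}"]) auto
qed

text \<open>The dichotomy is whether \<open>U\<close> decides almost the whole space. If it does,
  the decided part yields the bracket; if a set of positive measure stays undecided, splitting it
  repeatedly produces the independent sets that \<open>nosh\<close> excludes.\<close>

lemma (in prob_space) ultrafilter_bracket_or_shatters:
  fixes U :: "'a set filter"
  assumes sets: "\<C> \<subseteq> sets M" and U: "U \<noteq> bot" "eventually (\<lambda>C. C \<in> \<C>) U"
    and ultra: "\<And>P. eventually P U \<or> eventually (\<lambda>C. \<not> P C) U"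
    and "e > 0" and nosh: "\<not> shatters_card \<C> k"
  obtains A B where "A \<in> sets M" "B \<in> sets M" "prob (B - A) < e"
    "eventually (\<lambda>C. prob (A - C) = 0 \<and> prob (C - B) = 0) U"
proof (rule ccontr)
  assume nothesis: "\<not> thesis"
  \<comment> \<open>On a member of \<open>\<E>\<close>, \<open>U\<close>-most sets are known: they
    contain \<open>A\<close> and avoid \<open>B\<close>, up to null sets that may depend on
    \<open>C\<close>.\<close>
  define \<E> where "\<E> = {A \<union> B | A B. A \<in> events \<and> B \<in> events \<and>
     eventually (\<lambda>C. prob (A - C) = 0) U \<and> eventually (\<lambda>C. prob (B \<inter> C) = 0) U}"
  have \<E>I: "A \<union> B \<in> \<E>" if "A \<in> events" "B \<in> events" "eventually (\<lambda>C. prob (A - C) = 0) U"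
     "eventually (\<lambda>C. prob (B \<inter> C) = 0) U" for A B
    using that by (auto simp: \<E>_def)
  have ev_sets: "eventually (\<lambda>C. C \<in> events) U"
    using U(2) sets by (auto elim: eventually_mono)
  have null_Un: "prob (A \<union> B) = 0" if "A \<in> events" "B \<in> events" "prob A = 0" "prob B = 0" for A B
    using measure_Un_le[OF that(1,2)] that(3,4) by (simp add: measure_le_0_iff)
  obtain H where H: "H \<in> events" "\<And>E. E \<in> \<E> \<Longrightarrow> prob (E - H) = 0"
    "\<And>e. e > 0 \<Longrightarrow> \<exists>E\<in>\<E>. prob (H - E) < e"
  proof (rule union_closed_essential_sup[of \<E>])
    show "\<E> \<subseteq> events" by (auto simp: \<E>_def)
    show "\<E> \<noteq> {}" using \<E>I[of "{}" "{}"] by auto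
    fix E E' assume "E \<in> \<E>" "E' \<in> \<E>"
    then obtain A B A' B' where E: "E = A \<union> B" "E' = A' \<union> B'"
      and ev: "A \<in> events" "B \<in> events" "A' \<in> events" "B' \<in> events"
      and ae: "eventually (\<lambda>C. prob (A - C) = 0) U" "eventually (\<lambda>C. prob (B \<inter> C) = 0) U"
       "eventually (\<lambda>C. prob (A' - C) = 0) U" "eventually (\<lambda>C. prob (B' \<inter> C) = 0) U"
      by (auto simp: \<E>_def)
    have "eventually (\<lambda>C. prob ((A \<union> A') - C) = 0) U"
      using ae(1,3) ev_sets by eventually_elim (simp add: Un_Diff null_Un ev sets.Diff)
    moreover have "eventually (\<lambda>C. prob ((B \<union> B') \<inter> C) = 0) U"
      using ae(2,4) ev_sets by eventually_elim (simp add: Int_Un_distrib2 null_Un ev sets.Int)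
    ultimately have "(A \<union> A') \<union> (B \<union> B') \<in> \<E>" using ev by (intro \<E>I) auto
    then show "E \<union> E' \<in> \<E>" using E by (simp add: Un_ac)
  qed blast
  define K where "K = space M - H"
  have K: "K \<in> events" using H(1) by (auto simp: K_def)
  have "prob K \<noteq> 0"
  proof
    assume K0: "prob K = 0"
    obtain E where "E \<in> \<E>" and HE: "prob (H - E) < e" using H(3)[OF \<open>e > 0\<close>] by auto
    then obtain A B where E: "E = A \<union> B" and ev: "A \<in> events" "B \<in> events"
      and *: "eventually (\<lambda>C. prob (A - C) = 0) U" "eventually (\<lambda>C. prob (B \<inter> C) = 0) U"
      by (auto simp: \<E>_def)
    \<comment> \<open>The bracket runs from \<open>A\<close> to the complement of \<open>B\<close>;
      its gap is covered by the null set \<open>K\<close> and the small set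
      \<open>H - E\<close>.\<close>
    have "(space M - B) - A \<subseteq> K \<union> (H - E)" by (auto simp: K_def E)
    then have "prob ((space M - B) - A) \<le> prob (K \<union> (H - E))"
      using K H(1) ev E by (intro finite_measure_mono) auto
    also have "\<dots> \<le> prob K + prob (H - E)"
      using K H(1) ev E by (intro measure_Un_le) auto
    finally have "prob ((space M - B) - A) < e" using K0 HE by simp
    moreover have "eventually (\<lambda>C. prob (A - C) = 0 \<and> prob (C - (space M - B)) = 0) U"
      using * ev_sets
    proof eventually_elim
      case (elim C)
      have "C - (space M - B) = B \<inter> C" using sets.sets_into_space[OF elim(3)] by auto
      then show ?case using elim by simp
    qed
    ultimately show False using nothesis that ev by blast
  qed
  have split: "eventually (\<lambda>C. prob (E - C) > 0 \<and> prob (E \<inter> C) > 0) U"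
    if E: "E \<in> events" "E \<subseteq> K" "prob E > 0" for E
  proof -
    \<comment> \<open>A member of \<open>\<E>\<close> disjoint from \<open>H\<close> is null, so
      \<open>E\<close> is neither almost contained in nor almost avoided by \<open>U\<close>-most
      sets. The ultrafilter property turns these two failures into eventual statements.\<close>
    have "E - H = E" using E by (auto simp: K_def)
    then have "E \<notin> \<E>" using H(2)[of E] E by auto
    then have "\<not> eventually (\<lambda>C. prob (E - C) = 0) U" "\<not> eventually (\<lambda>C. prob (E \<inter> C) = 0) U"
      using \<E>I[of E "{}"] \<E>I[of "{}" E] E by auto
    then have "eventually (\<lambda>C. prob (E - C) \<noteq> 0) U" "eventually (\<lambda>C. prob (E \<inter> C) \<noteq> 0) U"
      using ultra by blast+
    then show ?thesis
      by eventually_elim (auto simp: zero_less_measure_iff)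
  qed
  \<comment> \<open>Each new set must cut all \<open>2 ^ n\<close> cells at once, a finite
    conjunction of eventual properties. The induction carries positive measure instead of
    nonemptiness because \<open>split\<close> requires it.\<close>
  have "\<exists>C. (\<forall>i<n. C i \<in> \<C>) \<and> (\<forall>T\<subseteq>{..<n}. prob (K \<inter> independent_cell C n T) > 0)" for n
  proof (induction n)
    case 0
    then show ?case using \<open>prob K \<noteq> 0\<close> by (simp add: independent_cell_def zero_less_measure_iff)
  next
    case (Suc n)
    then obtain C where C: "\<And>i. i < n \<Longrightarrow> C i \<in> \<C>"
      and pos: "\<And>T. T \<subseteq> {..<n} \<Longrightarrow> prob (K \<inter> independent_cell C n T) > 0" by auto
    have "K \<inter> independent_cell C n T = {x \<in> space M. x \<in> K \<and> (\<forall>i\<in>{..<n}. x \<in> C i \<longleftrightarrow> i \<in> T)}" for T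
      using sets.sets_into_space[OF K] by (auto simp: independent_cell_def)
    moreover have "{x \<in> space M. x \<in> K \<and> (\<forall>i\<in>{..<n}. x \<in> C i \<longleftrightarrow> i \<in> T)} \<in> events" for T
    proof -
      have [measurable]: "C i \<in> events" if "i \<in> {..<n}" for i using C that sets by auto
      have [measurable]: "K \<in> events" by (rule K)
      show ?thesis by measurable
    qed
    ultimately have cell: "K \<inter> independent_cell C n T \<in> events" for T by simp
    have "eventually (\<lambda>B. \<forall>T\<in>Pow {..<n}. prob (K \<inter> independent_cell C n T - B) > 0 \<and>
        prob (K \<inter> independent_cell C n T \<inter> B) > 0) U"
      using cell pos by (intro eventually_ball_finite ballI split) auto
    with U(2) have "eventually (\<lambda>B. B \<in> \<C> \<and> (\<forall>T\<in>Pow {..<n}. prob (K \<inter> independent_cell C n T - B) > 0 \<and>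
        prob (K \<inter> independent_cell C n T \<inter> B) > 0)) U"
      by (rule eventually_conj)
    then obtain B where B: "B \<in> \<C>"
      "\<And>T. T \<subseteq> {..<n} \<Longrightarrow> prob (K \<inter> independent_cell C n T - B) > 0"
      "\<And>T. T \<subseteq> {..<n} \<Longrightarrow> prob (K \<inter> independent_cell C n T \<inter> B) > 0"
      using eventually_happens'[OF U(1)] by (metis (no_types, lifting) Pow_iff)
    have "prob (K \<inter> independent_cell (C(n := B)) (Suc n) T) > 0" if "T \<subseteq> {..<Suc n}" for T
    proof -
      have *: "K \<inter> independent_cell (C(n := B)) (Suc n) T =
         (if n \<in> T then K \<inter> independent_cell C n (T - {n}) \<inter> B else K \<inter> independent_cell C n (T - {n}) - B)"
        by (auto simp: independent_cell_def less_Suc_eq)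
      have "T - {n} \<subseteq> {..<n}" using that by auto
      from B(2,3)[OF this] show ?thesis by (simp only: * split: if_split) blast
    qed
    moreover have "\<forall>i<Suc n. (C(n := B)) i \<in> \<C>" using C B by (auto simp: less_Suc_eq)
    ultimately show ?case by blast
  qed
  then obtain C where C: "\<forall>i<2 ^ k. C i \<in> \<C>"
    "\<forall>T\<subseteq>{..<2 ^ k}. prob (K \<inter> independent_cell C (2 ^ k) T) > 0" by blast
  have "shatters_card \<C> k"
  proof (rule shatters_card_if_independent[of k C])
    fix T :: "nat set" assume "T \<subseteq> {..<2 ^ k}"
    with C(2) have "prob (K \<inter> independent_cell C (2 ^ k) T) > 0" by blast
    then show "independent_cell C (2 ^ k) T \<noteq> {}" by auto
  qed (use C(1) in blast)
  with nosh show False by simp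
qed

text \<open>Instead of covering \<open>\<C>\<close> by finitely many brackets, it suffices to treat the subfamilies
  lying in a single bracket: the complements of the members of the ideal \<open>good\<close> form a filter.\<close>

lemma (in prob_space) not_shatters_bracket_induct:
  fixes \<C> :: "'a set set"
  assumes "\<C> \<subseteq> events" "\<not> shatters_card \<C> k" "e > 0"
    and union: "\<And>\<G> \<H>. good \<G> \<Longrightarrow> good \<H> \<Longrightarrow> good (\<G> \<union> \<H>)"
    and mono: "\<And>\<G> \<H>. good \<H> \<Longrightarrow> \<G> \<subseteq> \<H> \<Longrightarrow> good \<G>"
    and bracket: "\<And>A B. A \<in> events \<Longrightarrow> B \<in> events \<Longrightarrow> prob (B - A) < e \<Longrightarrow>
       good {C \<in> \<C>. prob (A - C) = 0 \<and> prob (C - B) = 0}"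
  shows "good \<C>"
proof (rule ccontr)
  assume bad: "\<not> good \<C>"
  have empty: "good {}" using bracket[of "{}" "{}"] \<open>e > 0\<close> mono[of _ "{}"] by auto
  define J where "J = Abs_filter (\<lambda>P. good {C \<in> \<C>. \<not> P C})"
  have J: "eventually P J \<longleftrightarrow> good {C \<in> \<C>. \<not> P C}" for P
    unfolding J_def
  proof (rule eventually_Abs_filter, unfold is_filter_def, intro conjI allI impI)
    fix P Q assume "good {C \<in> \<C>. \<not> P C}" "good {C \<in> \<C>. \<not> Q C}"
    from union[OF this] show "good {C \<in> \<C>. \<not> (P C \<and> Q C)}"
      by (rule mono) auto
  next
    fix P Q :: "'a set \<Rightarrow> bool" assume "\<forall>C. P C \<longrightarrow> Q C" "good {C \<in> \<C>. \<not> P C}"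
    then show "good {C \<in> \<C>. \<not> Q C}" by (elim mono) auto
  qed (simp add: empty)
  \<comment> \<open>\<open>J\<close> is proper because \<open>\<C>\<close> itself is not
    good.\<close>
  then have "J \<noteq> bot" using bad by (simp add: trivial_limit_def)
  then obtain U where U: "U \<le> J" "U \<noteq> bot"
    "\<And>P. eventually P U \<or> eventually (\<lambda>x. \<not> P x) U"
    by (rule ultrafilter_below) blast
  have U\<C>: "eventually (\<lambda>C. C \<in> \<C>) U" using J empty by (intro filter_leD[OF U(1)]) simp
  then obtain A B where AB: "A \<in> events" "B \<in> events" "prob (B - A) < e"
    and ev: "eventually (\<lambda>C. prob (A - C) = 0 \<and> prob (C - B) = 0) U"
    by (rule ultrafilter_bracket_or_shatters[OF assms(1) U(2) _ U(3) assms(3,2)]) blast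
  \<comment> \<open>The sets of \<open>\<C>\<close> within the bracket form a good family, so
    \<open>J\<close>, and with it \<open>U\<close>, eventually avoids the bracket that contains
    \<open>U\<close>-most sets.\<close>
  have "eventually (\<lambda>C. \<not> (prob (A - C) = 0 \<and> prob (C - B) = 0)) U"
    using bracket[OF AB] by (intro filter_leD[OF U(1)]) (simp add: J)
  with ev have "eventually (\<lambda>C. False) U" by eventually_elim auto
  then show False using U(2) by (simp add: trivial_limit_def)
qed

section \<open>The ergodic theorem for stationary processes\<close>

text \<open>This is the maximum of the partial sums of \<open>h (x i)\<close> over all lengths from
  \<open>0\<close> to \<open>n\<close>. The recursion peels off the first term because Garsia's
  argument compares length \<open>Suc n\<close> with length \<open>n\<close> on the shifted
  sequence.\<close>

primrec max_partial_sum :: "('a \<Rightarrow> real) \<Rightarrow> nat \<Rightarrow> (nat \<Rightarrow> 'a) \<Rightarrow> real" where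
  "max_partial_sum h 0 x = 0"
| "max_partial_sum h (Suc n) x = max 0 (h (x 0) + max_partial_sum h n (shift x))"

lemma max_partial_sum_nonneg: "0 \<le> max_partial_sum h n x"
  by (cases n) auto

lemma max_partial_sum_le_Suc: "max_partial_sum h n x \<le> max_partial_sum h (Suc n) x"
proof (induction n arbitrary: x)
  case (Suc n)
  show ?case
    using Suc[of "shift x"]
    by (simp only: max_partial_sum.simps max.mono add_mono order_refl)
qed simp

lemma max_partial_sum_mono: "m \<le> n \<Longrightarrow> max_partial_sum h m x \<le> max_partial_sum h n x"
  by (rule lift_Suc_mono_le[of "\<lambda>n. max_partial_sum h n x"]) (rule max_partial_sum_le_Suc)

lemma sum_le_max_partial_sum: "(\<Sum>i<n. h (x i)) \<le> max_partial_sum h n x"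
proof (induction n arbitrary: x)
  case (Suc n)
  have "(\<Sum>i<Suc n. h (x i)) = h (x 0) + (\<Sum>i<n. h (shift x i))"
    by (simp add: sum.lessThan_Suc_shift shift_def del: sum.lessThan_Suc)
  then show ?case using Suc[of "shift x"] by simp
qed simp

lemma max_partial_sum_le_sum_abs: "max_partial_sum h n x \<le> (\<Sum>i<n. \<bar>h (x i)\<bar>)"
proof (induction n arbitrary: x)
  case (Suc n)
  have "(\<Sum>i<Suc n. \<bar>h (x i)\<bar>) = \<bar>h (x 0)\<bar> + (\<Sum>i<n. \<bar>h (shift x i)\<bar>)"
    by (simp add: sum.lessThan_Suc_shift shift_def del: sum.lessThan_Suc)
  moreover have "0 \<le> (\<Sum>i<n. \<bar>h (shift x i)\<bar>)" by (simp add: sum_nonneg)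
  ultimately show ?case using Suc[of "shift x"] by simp
qed simp

lemma measurable_shift [measurable]:
  "shift \<in> measurable (seq_space :: (nat \<Rightarrow> 'a::topological_space) measure) seq_space"
  unfolding shift_def by (rule measurable_PiM_single') (auto simp: space_PiM)

lemma measurable_max_partial_sum:
  assumes [measurable]: "h \<in> borel_measurable (borel :: 'a::topological_space measure)"
  shows "max_partial_sum h n \<in> borel_measurable seq_space"
proof (induction n)
  case (Suc n)
  note [measurable] = Suc
  show ?case unfolding max_partial_sum.simps by measurable
qed simp

text \<open>The two families of sums differ by the fixed number \<open>h (x 0)\<close> and an index
  shift. This makes boundedness a shift-invariant event, to which ergodicity applies.\<close>

lemma bdd_above_sum_shift_iff:
  fixes h :: "'a \<Rightarrow> real"
  shows "bdd_above (range (\<lambda>n. \<Sum>i<n. h (shift x i))) \<longleftrightarrow> bdd_above (range (\<lambda>n. \<Sum>i<n. h (x i)))"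
proof -
  have *: "(\<Sum>i<Suc n. h (x i)) = h (x 0) + (\<Sum>i<n. h (shift x i))" for n
    by (simp add: sum.lessThan_Suc_shift shift_def del: sum.lessThan_Suc)
  show ?thesis
  proof
    assume "bdd_above (range (\<lambda>n. \<Sum>i<n. h (shift x i)))"
    then obtain c where c: "\<And>n. (\<Sum>i<n. h (shift x i)) \<le> c" by (auto simp: bdd_above_def)
    have "(\<Sum>i<n. h (x i)) \<le> max 0 (h (x 0) + c)" for n
      using c[of "n - 1"] by (cases n) (auto simp only: * diff_Suc_1, auto)
    then show "bdd_above (range (\<lambda>n. \<Sum>i<n. h (x i)))" by (auto intro!: bdd_aboveI)
  next
    assume "bdd_above (range (\<lambda>n. \<Sum>i<n. h (x i)))"
    then obtain c where c: "\<And>n. (\<Sum>i<n. h (x i)) \<le> c" by (auto simp: bdd_above_def)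
    have "(\<Sum>i<n. h (shift x i)) \<le> c - h (x 0)" for n
      using c[of "Suc n"] unfolding * by simp
    then show "bdd_above (range (\<lambda>n. \<Sum>i<n. h (shift x i)))" by (auto intro!: bdd_aboveI)
  qed
qed

section \<open>Shift invariance of expectations and Garsia's argument\<close>

locale ergodic_process = prob_space M
  for M :: "'w measure" and X :: "nat \<Rightarrow> 'w \<Rightarrow> 'a::topological_space" +
  assumes measurable_X [measurable]: "\<And>i. X i \<in> borel_measurable M"
    and stationary: "stationary M X"
    and ergodic: "ergodic M X"
begin

lemma measurable_path [measurable]: "(\<lambda>\<omega> i. X (i + k) \<omega>) \<in> measurable M seq_space"
  by (rule measurable_PiM_single') (auto simp: space_PiM)

lemma distr_shift: "distr M seq_space (\<lambda>\<omega> i. X (i + k) \<omega>) = distr M seq_space (\<lambda>\<omega> i. X i \<omega>)"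
  using stationary by (simp add: stationary_def)

lemma
  fixes f :: "(nat \<Rightarrow> 'a) \<Rightarrow> real"
  assumes [measurable]: "f \<in> borel_measurable seq_space"
  shows integral_path_shift: "(\<integral>\<omega>. f (\<lambda>i. X (i + k) \<omega>) \<partial>M) = (\<integral>\<omega>. f (\<lambda>i. X i \<omega>) \<partial>M)"
    and integrable_path_shift_iff:
      "integrable M (\<lambda>\<omega>. f (\<lambda>i. X (i + k) \<omega>)) \<longleftrightarrow> integrable M (\<lambda>\<omega>. f (\<lambda>i. X i \<omega>))"
proof -
  show "(\<integral>\<omega>. f (\<lambda>i. X (i + k) \<omega>) \<partial>M) = (\<integral>\<omega>. f (\<lambda>i. X i \<omega>) \<partial>M)"
    using distr_shift[of k] integral_distr[OF measurable_path[of k] assms]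
      integral_distr[OF measurable_path[of 0] assms] by simp
  show "integrable M (\<lambda>\<omega>. f (\<lambda>i. X (i + k) \<omega>)) \<longleftrightarrow> integrable M (\<lambda>\<omega>. f (\<lambda>i. X i \<omega>))"
    using distr_shift[of k] integrable_distr_eq[OF measurable_path[of k] assms]
      integrable_distr_eq[OF measurable_path[of 0] assms] by simp
qed

lemma
  fixes g :: "'a \<Rightarrow> real"
  assumes [measurable]: "g \<in> borel_measurable borel"
  shows integral_X: "(\<integral>\<omega>. g (X k \<omega>) \<partial>M) = (\<integral>\<omega>. g (X 0 \<omega>) \<partial>M)"
    and integrable_X_iff: "integrable M (\<lambda>\<omega>. g (X k \<omega>)) \<longleftrightarrow> integrable M (\<lambda>\<omega>. g (X 0 \<omega>))"
  using integral_path_shift[of "\<lambda>x. g (x 0)" k] integrable_path_shift_iff[of "\<lambda>x. g (x 0)" k]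
  by simp_all

text \<open>Ergodicity makes unboundedness an event of probability zero or one. In the second case
  the differences \<open>D n\<close> have nonnegative mean by stationarity and converge to
  \<open>h (X 0 \<omega>)\<close>, which contradicts \<open>neg\<close>.\<close>

lemma AE_bdd_above_sum:
  fixes h :: "'a \<Rightarrow> real"
  assumes [measurable]: "h \<in> borel_measurable borel"
    and int: "integrable M (\<lambda>\<omega>. h (X 0 \<omega>))" and neg: "(\<integral>\<omega>. h (X 0 \<omega>) \<partial>M) < 0"
  shows "AE \<omega> in M. bdd_above (range (\<lambda>n. \<Sum>i<n. h (X i \<omega>)))"
proof -
  define Y where "Y = (\<lambda>\<omega> i. X i \<omega>)"
  let ?R = "max_partial_sum h"
  have [measurable]: "Y \<in> measurable M seq_space"
    using measurable_path[of 0] by (simp add: Y_def)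
  note [measurable] = measurable_max_partial_sum
  define A where "A = {x :: nat \<Rightarrow> 'a. \<not> bdd_above (range (\<lambda>n. \<Sum>i<n. h (x i)))}"
  \<comment> \<open>Restricting the bounds to natural numbers leaves only countable quantifiers,
    which gives measurability.\<close>
  have "A = {x \<in> space seq_space. \<not> (\<exists>c::nat. \<forall>n. (\<Sum>i<n. h (x i)) \<le> real c)}"
  proof -
    have "bdd_above (range s) \<longleftrightarrow> (\<exists>c::nat. \<forall>n. s n \<le> real c)" for s :: "nat \<Rightarrow> real"
      unfolding bdd_above_def by (auto, meson order_trans real_arch_simple)
    then show ?thesis by (auto simp: A_def space_PiM)
  qed
  also have "\<dots> \<in> sets seq_space" by measurable
  finally have A [measurable]: "A \<in> sets seq_space" .
  have "shift -` A = A" by (auto simp: A_def bdd_above_sum_shift_iff)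
  with A have "{\<omega> \<in> space M. Y \<omega> \<in> A} \<in> invariant_events M X"
    by (auto simp: invariant_events_def shift_invariant_sets_def Y_def)
  with ergodic have "prob {\<omega> \<in> space M. Y \<omega> \<in> A} = 0 \<or> prob {\<omega> \<in> space M. Y \<omega> \<in> A} = 1"
    by (auto simp: ergodic_def)
  then show ?thesis
  proof
    assume "prob {\<omega> \<in> space M. Y \<omega> \<in> A} = 0"
    then have "AE \<omega> in M. Y \<omega> \<notin> A"
      by (subst (asm) prob_eq_0) auto
    then show ?thesis by (auto simp: A_def Y_def)
  next
    assume "prob {\<omega> \<in> space M. Y \<omega> \<in> A} = 1"
    then have AE_A: "AE \<omega> in M. Y \<omega> \<in> A"
      by (subst (asm) prob_Collect_eq_1) auto
    define D where "D n \<omega> = ?R (Suc n) (Y \<omega>) - ?R n (shift (Y \<omega>))" for n \<omega>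
    \<comment> \<open>This form serves dominated convergence twice: since the maximal sum is
      nonnegative, \<open>\<bar>D n \<omega>\<bar> \<le> \<bar>h (X 0 \<omega>)\<bar>\<close>, and
      once that sum reaches \<open>- h (X 0 \<omega>)\<close> the value is exactly
      \<open>h (X 0 \<omega>)\<close>.\<close>
    have D: "D n \<omega> = max (- ?R n (shift (Y \<omega>))) (h (X 0 \<omega>))" for n \<omega>
      by (simp add: D_def Y_def max_def)
    have intR: "integrable M (\<lambda>\<omega>. ?R n (Y \<omega>))" for n
    proof (rule Bochner_Integration.integrable_bound)
      show "integrable M (\<lambda>\<omega>. \<Sum>i<n. \<bar>h (X i \<omega>)\<bar>)"
        using int by (intro Bochner_Integration.integrable_sum integrable_abs) (rule iffD2[OF integrable_X_iff], auto)
      show "AE \<omega> in M. norm (?R n (Y \<omega>)) \<le> norm (\<Sum>i<n. \<bar>h (X i \<omega>)\<bar>)"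
        using max_partial_sum_nonneg[of h n] max_partial_sum_le_sum_abs[of h n]
        by (auto simp: Y_def sum_nonneg)
    qed simp
    have "shift (Y \<omega>) = (\<lambda>i. X (i + 1) \<omega>)" for \<omega> by (simp add: shift_def Y_def)
    then have intRs: "integrable M (\<lambda>\<omega>. ?R n (shift (Y \<omega>)))"
        and eqRs: "(\<integral>\<omega>. ?R n (shift (Y \<omega>)) \<partial>M) = (\<integral>\<omega>. ?R n (Y \<omega>) \<partial>M)" for n
      using intR[of n] integrable_path_shift_iff[of "?R n" 1] integral_path_shift[of "?R n" 1]
      by (simp_all add: Y_def)
    have "0 \<le> (\<integral>\<omega>. D n \<omega> \<partial>M)" for n
    proof -
      have "(\<integral>\<omega>. D n \<omega> \<partial>M) = (\<integral>\<omega>. ?R (Suc n) (Y \<omega>) \<partial>M) - (\<integral>\<omega>. ?R n (Y \<omega>) \<partial>M)"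
        unfolding D_def eqRs[of n, symmetric] by (intro Bochner_Integration.integral_diff intR intRs)
      moreover have "(\<integral>\<omega>. ?R n (Y \<omega>) \<partial>M) \<le> (\<integral>\<omega>. ?R (Suc n) (Y \<omega>) \<partial>M)"
        by (intro integral_mono intR max_partial_sum_le_Suc)
      ultimately show ?thesis by simp
    qed
    moreover have "(\<lambda>n. \<integral>\<omega>. D n \<omega> \<partial>M) \<longlonglongrightarrow> (\<integral>\<omega>. h (X 0 \<omega>) \<partial>M)"
    proof (rule integral_dominated_convergence)
      show "integrable M (\<lambda>\<omega>. \<bar>h (X 0 \<omega>)\<bar>)" using int by simp
      show "AE \<omega> in M. (\<lambda>n. D n \<omega>) \<longlonglongrightarrow> h (X 0 \<omega>)"
        using AE_A
      proof eventually_elim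
        case (elim \<omega>)
        then have "\<not> bdd_above (range (\<lambda>n. \<Sum>i<n. h (shift (Y \<omega>) i)))"
          by (simp add: A_def bdd_above_sum_shift_iff)
        then obtain m where m: "- h (X 0 \<omega>) < (\<Sum>i<m. h (shift (Y \<omega>) i))"
          by (auto simp: bdd_above_def not_le)
        have "D n \<omega> = h (X 0 \<omega>)" if "n \<ge> m" for n
          unfolding D using m sum_le_max_partial_sum[where x = "shift (Y \<omega>)" and n = m and h = h]
            max_partial_sum_mono[OF that, of h "shift (Y \<omega>)"] by simp
        then show ?case
          by (intro tendsto_eventually) (auto simp: eventually_sequentially)
      qed
      show "AE \<omega> in M. norm (D n \<omega>) \<le> \<bar>h (X 0 \<omega>)\<bar>" for n
      proof (rule AE_I2)
        fix \<omega>
        show "norm (D n \<omega>) \<le> \<bar>h (X 0 \<omega>)\<bar>"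
          unfolding D using max_partial_sum_nonneg[of h n "shift (Y \<omega>)"] by (auto simp: max_def abs_if)
      qed
      show "D n \<in> borel_measurable M" for n unfolding D_def by measurable
    qed simp
    ultimately have "0 \<le> (\<integral>\<omega>. h (X 0 \<omega>) \<partial>M)"
      by (intro LIMSEQ_le_const) auto
    with neg show ?thesis by simp
  qed
qed

text \<open>After subtracting a constant slightly above the mean, the partial sums are bounded
  above, and division by \<open>m\<close> makes the bound negligible. Tolerances
  \<open>1 / Suc k\<close> keep the quantifier countable, so one null event serves for all
  \<open>k\<close>.\<close>

lemma AE_average_less:
  fixes g :: "'a \<Rightarrow> real"
  assumes [measurable]: "g \<in> borel_measurable borel"
    and int: "integrable M (\<lambda>\<omega>. g (X 0 \<omega>))"
  shows "AE \<omega> in M. \<forall>k. eventually (\<lambda>m. (1 / real m) * (\<Sum>i<m. g (X i \<omega>)) <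
    (\<integral>\<omega>. g (X 0 \<omega>) \<partial>M) + 1 / Suc k) sequentially"
  unfolding AE_all_countable
proof
  fix k :: nat
  \<comment> \<open>Half of the tolerance makes the mean negative, the other half absorbs
    \<open>c / m\<close>.\<close>
  define d :: real where "d = 1 / (2 * Suc k)"
  have d: "d > 0" "1 / real (Suc k) = 2 * d" by (auto simp: d_def field_simps)
  define E where "E = (\<integral>\<omega>. g (X 0 \<omega>) \<partial>M)"
  have "(\<integral>\<omega>. g (X 0 \<omega>) - (E + d) \<partial>M) = E - (E + d)"
    unfolding E_def using int by (subst Bochner_Integration.integral_diff) (auto simp: prob_space)
  then have "AE \<omega> in M. bdd_above (range (\<lambda>n. \<Sum>i<n. g (X i \<omega>) - (E + d)))"
    using int d by (intro AE_bdd_above_sum[of "\<lambda>x. g x - (E + d)"]) auto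
  then show "AE \<omega> in M. eventually (\<lambda>m. (1 / real m) * (\<Sum>i<m. g (X i \<omega>)) <
    (\<integral>\<omega>. g (X 0 \<omega>) \<partial>M) + 1 / Suc k) sequentially"
  proof eventually_elim
    case (elim \<omega>)
    then obtain c where c: "\<And>n. (\<Sum>i<n. g (X i \<omega>) - (E + d)) \<le> c"
      by (auto simp: bdd_above_def)
    have c': "(\<Sum>i<n. g (X i \<omega>)) \<le> c + n * (E + d)" for n
      using c[of n] by (simp add: sum_subtractf)
    have "eventually (\<lambda>m. c / d < real m) sequentially"
      using filterlim_real_sequentially by (simp add: filterlim_at_top_dense)
    then show ?case
      using eventually_gt_at_top[of 0]
    proof eventually_elim
      case (elim m)
      then have "c < m * d" using d by (simp add: field_simps)
      then have "(\<Sum>i<m. g (X i \<omega>)) < m * (E + 2 * d)" using c'[of m] by (simp add: algebra_simps)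
      then show ?case unfolding d(2) E_def[symmetric] using elim by (simp add: field_simps)
    qed
  qed
qed

text \<open>The one-sided estimate is applied to \<open>g\<close> and to \<open>- g\<close>.\<close>

theorem ergodic_average:
  fixes g :: "'a \<Rightarrow> real"
  assumes [measurable]: "g \<in> borel_measurable borel"
    and int: "integrable M (\<lambda>\<omega>. g (X 0 \<omega>))"
  shows "AE \<omega> in M. (\<lambda>m. (1 / real m) * (\<Sum>i<m. g (X i \<omega>))) \<longlonglongrightarrow> (\<integral>\<omega>. g (X 0 \<omega>) \<partial>M)"
proof -
  have "AE \<omega> in M. \<forall>k. eventually (\<lambda>m. (1 / real m) * (\<Sum>i<m. - g (X i \<omega>)) <
    (\<integral>\<omega>. - g (X 0 \<omega>) \<partial>M) + 1 / Suc k) sequentially"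
    using int by (intro AE_average_less) auto
  with AE_average_less[OF assms] show ?thesis
  proof eventually_elim
    case (elim \<omega>)
    show ?case
    proof (rule tendstoI)
      fix e :: real assume "e > 0"
      then obtain k where k: "1 / Suc k < e" using nat_approx_posE by metis
      from elim[THEN spec[of _ k]]
      show "eventually (\<lambda>m. dist ((1 / real m) * (\<Sum>i<m. g (X i \<omega>))) (\<integral>\<omega>. g (X 0 \<omega>) \<partial>M) < e) sequentially"
      proof eventually_elim
        case (elim m)
        then show ?case using k by (simp add: dist_real_def sum_negf abs_less_iff)
      qed
    qed
  qed
qed

end

section \<open>Uniform convergence\<close>

text \<open>The points \<open>j / n - n\<close> with \<open>j < 2n\<^sup>2\<close> divide \<open>[-n, n]\<close> into steps of length \<open>1 / n\<close>.\<close>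

lemma threshold_count_approx:
  fixes y :: real and n :: nat
  assumes "n > 0"
  shows "\<bar>y - (n - (1 / n) * (\<Sum>j<2 * n * n. indicator {..real j / n - n} y))\<bar>
    \<le> 1 / n + (if \<bar>y\<bar> > n then \<bar>y\<bar> else 0)"
proof -
  \<comment> \<open>\<open>c\<close> is the least natural index whose threshold is at least
    \<open>y\<close>, so the sum counts the indices from \<open>c\<close> on. The natural
    subtraction in \<open>2 * n * n - c\<close> yields \<open>0\<close> when \<open>y\<close> lies
    above all thresholds.\<close>
  define c where "c = nat \<lceil>n * (y + n)\<rceil>"
  have iff: "y \<le> real j / n - n \<longleftrightarrow> c \<le> j" for j :: nat
  proof -
    have "y \<le> real j / n - n \<longleftrightarrow> n * (y + n) \<le> real j"
      using assms by (simp add: field_simps)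
    then show ?thesis by (simp add: c_def nat_le_iff ceiling_le_iff)
  qed
  have "(\<Sum>j<2 * n * n. indicator {..real j / n - n} y) = (\<Sum>j<2 * n * n. of_bool (c \<le> j) :: real)"
    by (intro sum.cong refl) (auto simp: indicator_def iff)
  also have "\<dots> = real (card {c..<2 * n * n})"
  proof -
    have "{..<2 * n * n} \<inter> {j. c \<le> j} = {c..<2 * n * n}" by auto
    then show ?thesis by (simp add: of_bool_def sum.If_cases)
  qed
  finally have S: "(\<Sum>j<2 * n * n. indicator {..real j / n - n} y) = real (2 * n * n - c)" by simp
  have n: "real n > 0" and n': "1 / real n > 0" using assms by simp_all
  \<comment> \<open>Outside the interval the approximant is \<open>-n\<close> or \<open>n\<close>
    and the tail term absorbs the error; inside, it rounds \<open>y\<close> up to the grid.\<close>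
  consider "y \<le> - n" | "y \<ge> n" | "- n < y" "y < n" by linarith
  then show ?thesis
  proof cases
    case 1
    then have "n * (y + n) \<le> 0" using n by (simp add: mult_nonneg_nonpos)
    then have "c = 0" by (simp add: c_def ceiling_le_iff)
    then have "n - (1 / n) * real (2 * n * n - c) = - real n" using n by simp
    then show ?thesis unfolding S using 1 n n' by (simp only: split: if_split) linarith
  next
    case 2
    then have "real n * (2 * n) \<le> n * (y + n)" using n by (intro mult_left_mono) auto
    also have "\<dots> \<le> c" unfolding c_def by (rule real_nat_ceiling_ge)
    finally have "real (2 * n * n) \<le> real c" by (simp add: mult_ac)
    then have "2 * n * n \<le> c" by (simp only: of_nat_le_iff)
    then have "n - (1 / n) * real (2 * n * n - c) = real n" by simp
    then show ?thesis unfolding S using 2 n n' by (simp only: split: if_split) linarith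
  next
    case 3
    have pos: "n * (y + n) > 0" using 3 n by simp
    have "n * (y + n) \<le> real n * (2 * n)" using 3 n by (intro mult_left_mono) auto
    then have "\<lceil>n * (y + n)\<rceil> \<le> int (2 * n * n)" by (simp add: ceiling_le_iff mult_ac)
    then have c: "c \<le> 2 * n * n" by (simp add: c_def nat_le_iff)
    have c1: "n * (y + n) \<le> c" unfolding c_def by (rule real_nat_ceiling_ge)
    have "real c = of_int \<lceil>n * (y + n)\<rceil>" using pos by (simp add: c_def)
    then have c2: "c < n * (y + n) + 1" using ceiling_correct[of "n * (y + n)"] by linarith
    have "n - (1 / n) * real (2 * n * n - c) = c / n - n"
      using c n by (simp add: of_nat_diff field_simps)
    moreover have "y \<le> c / n - n"
      using c1 n by (simp add: field_simps)
    moreover have "c / n \<le> (n * (y + n) + 1) / n"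
      using c2 n by (intro divide_right_mono) auto
    moreover have "(n * (y + n) + 1) / n = y + n + 1 / n"
      using n by (simp add: field_simps)
    ultimately have "\<bar>y - (n - (1 / n) * real (2 * n * n - c))\<bar> \<le> 1 / n" by linarith
    then show ?thesis unfolding S by (simp split: if_split)
  qed
qed

section \<open>Uniform convergence over families of sets\<close>

context ergodic_process
begin

abbreviation average :: "('a \<Rightarrow> real) \<Rightarrow> nat \<Rightarrow> 'w \<Rightarrow> real" where
  "average g m \<omega> \<equiv> (1 / real m) * (\<Sum>i<m. g (X i \<omega>))"

abbreviation mean :: "('a \<Rightarrow> real) \<Rightarrow> real" where
  "mean g \<equiv> \<integral>\<omega>. g (X 0 \<omega>) \<partial>M"

lemma average_mono:
  assumes "\<And>i. g (X i \<omega>) \<le> h (X i \<omega>)"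
  shows "average g m \<omega> \<le> average h m \<omega>"
  using assms by (intro mult_left_mono sum_mono) auto

lemma mean_indicator:
  assumes "D \<in> sets borel"
  shows "mean (indicator D) = measure (distr M borel (X 0)) D"
  using integral_distr[of "X 0" M borel "indicator D :: _ \<Rightarrow> real"] assms by simp

text \<open>By stationarity each \<open>X i\<close> has the law of \<open>X 0\<close>, so each of
  the countably many indices contributes a null event.\<close>

lemma AE_X_notin:
  assumes D [measurable]: "D \<in> sets borel" and "measure (distr M borel (X 0)) D = 0"
  shows "AE \<omega> in M. \<forall>i. X i \<omega> \<notin> D"
  unfolding AE_all_countable
proof
  fix i
  have "{\<omega> \<in> space M. X i \<omega> \<in> D} \<inter> space M = {\<omega> \<in> space M. X i \<omega> \<in> D}" by auto
  then have "prob {\<omega> \<in> space M. X i \<omega> \<in> D} = (\<integral>\<omega>. indicator {\<omega> \<in> space M. X i \<omega> \<in> D} \<omega> \<partial>M)"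
    using Bochner_Integration.integral_indicator[of M "{\<omega> \<in> space M. X i \<omega> \<in> D}"] by metis
  also have "\<dots> = (\<integral>\<omega>. indicator D (X i \<omega>) \<partial>M)"
    by (rule Bochner_Integration.integral_cong) (auto simp: indicator_def)
  also have "\<dots> = mean (indicator D)" by (rule integral_X) simp
  finally have "prob {\<omega> \<in> space M. X i \<omega> \<in> D} = 0" using assms by (simp add: mean_indicator)
  then show "AE \<omega> in M. X i \<omega> \<notin> D" by (subst (asm) prob_eq_0) auto
qed

text \<open>Almost sure uniform closeness passes to subfamilies and to unions of two families, so
  the bracket induction reduces the claim to a single bracket. There the averages are squeezed
  between those of \<open>A\<close> and \<open>B\<close>, to which the ergodic theorem
  applies.\<close>

lemma AE_eventually_close_on_sets:
  fixes \<C> :: "'a set set"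
  assumes "countable \<C>" and \<C>: "\<C> \<subseteq> sets borel" and "\<not> shatters_card \<C> k" and "e > 0"
  shows "AE \<omega> in M. eventually (\<lambda>m. \<forall>C\<in>\<C>.
    \<bar>average (indicator C) m \<omega> - mean (indicator C)\<bar> \<le> e) sequentially"
proof -
  define \<mu> where "\<mu> = distr M borel (X 0)"
  interpret \<mu>: prob_space \<mu> unfolding \<mu>_def by (rule prob_space_distr) simp
  have sets_\<mu> [simp]: "sets \<mu> = sets borel" by (simp add: \<mu>_def)
  have mean: "mean (indicator D) = \<mu>.prob D" if "D \<in> sets borel" for D
    using mean_indicator[OF that] by (simp add: \<mu>_def)
  show ?thesis
  proof (rule \<mu>.not_shatters_bracket_induct[OF _ assms(3,4)])
    show "\<C> \<subseteq> \<mu>.events" using \<C> by simp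
  next
    fix \<G> \<H>
    assume "AE \<omega> in M. eventually (\<lambda>m. \<forall>C\<in>\<G>.
        \<bar>average (indicator C) m \<omega> - mean (indicator C)\<bar> \<le> e) sequentially"
      and "AE \<omega> in M. eventually (\<lambda>m. \<forall>C\<in>\<H>.
        \<bar>average (indicator C) m \<omega> - mean (indicator C)\<bar> \<le> e) sequentially"
    then show "AE \<omega> in M. eventually (\<lambda>m. \<forall>C\<in>\<G> \<union> \<H>.
        \<bar>average (indicator C) m \<omega> - mean (indicator C)\<bar> \<le> e) sequentially"
      by eventually_elim (auto elim: eventually_elim2)
  next
    fix \<G> \<H> :: "'a set set"
    assume "AE \<omega> in M. eventually (\<lambda>m. \<forall>C\<in>\<H>.
        \<bar>average (indicator C) m \<omega> - mean (indicator C)\<bar> \<le> e) sequentially" and "\<G> \<subseteq> \<H>"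
    then show "AE \<omega> in M. eventually (\<lambda>m. \<forall>C\<in>\<G>.
        \<bar>average (indicator C) m \<omega> - mean (indicator C)\<bar> \<le> e) sequentially"
      by (auto elim!: eventually_mono)
  next
    fix A B assume AB: "A \<in> \<mu>.events" "B \<in> \<mu>.events" and gap: "\<mu>.prob (B - A) < e"
    define \<G> where "\<G> = {C \<in> \<C>. \<mu>.prob (A - C) = 0 \<and> \<mu>.prob (C - B) = 0}"
    have "countable \<G>" using assms(1) by (rule countable_subset[rotated]) (auto simp: \<G>_def)
    have bound: "\<mu>.prob D \<le> \<mu>.prob E" if "\<mu>.prob (D - E) = 0" "D \<in> sets borel" "E \<in> sets borel" for D E
    proof -
      have "\<mu>.prob D \<le> \<mu>.prob (E \<union> (D - E))"
        using that by (intro \<mu>.finite_measure_mono) auto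
      also have "\<dots> \<le> \<mu>.prob E + \<mu>.prob (D - E)" using that by (intro measure_Un_le) auto
      finally show ?thesis using that by simp
    qed
    have gap': "\<mu>.prob B \<le> \<mu>.prob A + \<mu>.prob (B - A)"
    proof -
      have "\<mu>.prob B \<le> \<mu>.prob (A \<union> (B - A))"
        using AB by (intro \<mu>.finite_measure_mono) auto
      also have "\<dots> \<le> \<mu>.prob A + \<mu>.prob (B - A)" using AB by (intro measure_Un_le) auto
      finally show ?thesis .
    qed
    \<comment> \<open>The slack left by the bracket: an error below \<open>d\<close> at either end
      plus the gap stays below \<open>e\<close>.\<close>
    define d where "d = e - \<mu>.prob (B - A)"
    have "d > 0" using gap by (simp add: d_def)
    \<comment> \<open>The bracket holds only up to null sets that depend on \<open>C\<close>;
      countability of \<open>\<G>\<close> merges the exceptional events into one.\<close>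
    have notin: "AE \<omega> in M. \<forall>C\<in>\<G>. (\<forall>i. X i \<omega> \<notin> A - C) \<and> (\<forall>i. X i \<omega> \<notin> C - B)"
    proof (rule AE_ball_countable'[OF _ \<open>countable \<G>\<close>])
      fix C assume "C \<in> \<G>"
      then show "AE \<omega> in M. (\<forall>i. X i \<omega> \<notin> A - C) \<and> (\<forall>i. X i \<omega> \<notin> C - B)"
        using \<C> AB by (intro AE_conjI AE_X_notin) (auto simp: \<G>_def \<mu>_def)
    qed
    have lim: "AE \<omega> in M. (\<lambda>m. average (indicator D) m \<omega>) \<longlonglongrightarrow> \<mu>.prob D"
      if D: "D \<in> sets borel" for D
    proof -
      have "AE \<omega> in M. (\<lambda>m. average (indicator D) m \<omega>) \<longlonglongrightarrow> mean (indicator D)"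
        using D by (intro ergodic_average integrable_const_bound[of _ 1]) auto
      then show ?thesis by (simp only: mean[OF D])
    qed
    have "AE \<omega> in M. eventually (\<lambda>m. \<forall>C\<in>\<G>.
        \<bar>average (indicator C) m \<omega> - mean (indicator C)\<bar> \<le> e) sequentially"
      using notin lim[of A, OF AB(1)[simplified]] lim[of B, OF AB(2)[simplified]]
    proof eventually_elim
      case (elim \<omega>)
      note in_bracket = elim(1)
      have "eventually (\<lambda>m. dist (average (indicator A) m \<omega>) (\<mu>.prob A) < d) sequentially"
        "eventually (\<lambda>m. dist (average (indicator B) m \<omega>) (\<mu>.prob B) < d) sequentially"
        using elim(2,3) \<open>d > 0\<close> by (auto dest: tendstoD)
      then show ?case
      proof eventually_elim
        case (elim m)
        show ?case
        proof
          fix C assume "C \<in> \<G>"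
          then have C: "C \<in> sets borel" "\<mu>.prob (A - C) = 0" "\<mu>.prob (C - B) = 0"
            using \<C> by (auto simp: \<G>_def)
          have "average (indicator A) m \<omega> \<le> average (indicator C) m \<omega>"
            "average (indicator C) m \<omega> \<le> average (indicator B) m \<omega>"
            using in_bracket \<open>C \<in> \<G>\<close> by (intro average_mono; auto simp: indicator_def)+
          moreover have "\<mu>.prob A \<le> \<mu>.prob C" "\<mu>.prob C \<le> \<mu>.prob B"
            using bound C AB by simp_all
          ultimately show "\<bar>average (indicator C) m \<omega> - mean (indicator C)\<bar> \<le> e"
            using elim gap' unfolding mean[OF C(1)] dist_real_def d_def by linarith
        qed
      qed
    qed
    then show "AE \<omega> in M. eventually (\<lambda>m. \<forall>C\<in>{C \<in> \<C>. \<mu>.prob (A - C) = 0 \<and> \<mu>.prob (C - B) = 0}.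
        \<bar>average (indicator C) m \<omega> - mean (indicator C)\<bar> \<le> e) sequentially"
      by (simp only: \<G>_def)
  qed
qed

section \<open>From sublevel sets to functions\<close>

lemma abs_average_le:
  assumes "\<And>i. \<bar>g (X i \<omega>)\<bar> \<le> h (X i \<omega>)"
  shows "\<bar>average g m \<omega>\<bar> \<le> average h m \<omega>"
proof -
  have "\<bar>\<Sum>i<m. g (X i \<omega>)\<bar> \<le> (\<Sum>i<m. h (X i \<omega>))"
    using assms by (intro order_trans[OF sum_abs] sum_mono)
  then show ?thesis by (simp add: abs_mult divide_right_mono)
qed

text \<open>\<open>f\<close> is replaced by the step function \<open>s\<close> built from its
  sublevel sets. The error \<open>1 / n + T\<close> enters once in the average and once in the mean;
  the constant \<open>n\<close> in \<open>s\<close> cancels between the two.\<close>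

lemma average_minus_mean_le_levels:
  fixes f F :: "'a \<Rightarrow> real" and n :: nat
  assumes [measurable]: "f \<in> borel_measurable borel" "F \<in> borel_measurable borel"
    and env: "\<And>x. \<bar>f x\<bar> \<le> F x" and int: "integrable M (\<lambda>\<omega>. F (X 0 \<omega>))"
    and "n > 0" "m > 0"
  defines "T \<equiv> \<lambda>x. if F x > n then F x else 0"
  defines "L \<equiv> \<lambda>j. sublevel f (real j / n - n)"
  shows "\<bar>average f m \<omega> - mean f\<bar> \<le> 2 / n + average T m \<omega> + mean T +
    (1 / n) * (\<Sum>j<2 * n * n. \<bar>average (indicator (L j)) m \<omega> - mean (indicator (L j))\<bar>)"
proof -
  define s where "s x = n - (1 / n) * (\<Sum>j<2 * n * n. indicator (L j) x)" for x
  have [measurable]: "L j \<in> sets borel" for j unfolding L_def sublevel_def by measurable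
  have [measurable]: "T \<in> borel_measurable borel" unfolding T_def by measurable
  have [measurable]: "s \<in> borel_measurable borel" unfolding s_def by measurable
  have F0: "0 \<le> F x" for x using env[of x] by linarith
  have fs: "\<bar>f x - s x\<bar> \<le> 1 / n + T x" for x
  proof -
    have "s x = n - (1 / n) * (\<Sum>j<2 * n * n. indicator {..real j / n - n} (f x))"
      unfolding s_def L_def sublevel_def by (simp add: indicator_def)
    then have "\<bar>f x - s x\<bar> \<le> 1 / n + (if \<bar>f x\<bar> > n then \<bar>f x\<bar> else 0)"
      using threshold_count_approx[OF \<open>n > 0\<close>, of "f x"] by simp
    also have "\<dots> \<le> 1 / n + T x" using env[of x] F0[of x] by (auto simp: T_def)
    finally show ?thesis .
  qed
  have intT: "integrable M (\<lambda>\<omega>. T (X 0 \<omega>))"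
    by (rule Bochner_Integration.integrable_bound[OF int]) (auto simp: T_def F0)
  have intf: "integrable M (\<lambda>\<omega>. f (X 0 \<omega>))"
    by (rule Bochner_Integration.integrable_bound[OF int]) (auto simp: env abs_of_nonneg[OF F0])
  have intL: "integrable M (\<lambda>\<omega>. indicator (L j) (X 0 \<omega>) :: real)" for j
    by (rule integrable_const_bound[of _ 1]) auto
  have ints: "integrable M (\<lambda>\<omega>. s (X 0 \<omega>))"
    unfolding s_def using intL by (intro Bochner_Integration.integrable_diff integrable_mult_right
        Bochner_Integration.integrable_sum) auto
  have "average f m \<omega> - average s m \<omega> = average (\<lambda>x. f x - s x) m \<omega>"
    by (simp add: sum_subtractf right_diff_distrib diff_divide_distrib)
  also have "\<bar>\<dots>\<bar> \<le> average (\<lambda>x. 1 / n + T x) m \<omega>" using fs by (rule abs_average_le)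
  also have "\<dots> = 1 / n + average T m \<omega>" using \<open>m > 0\<close> by (simp add: sum.distrib field_simps)
  finally have A: "\<bar>average f m \<omega> - average s m \<omega>\<bar> \<le> 1 / n + average T m \<omega>" .
  have "mean f - mean s = mean (\<lambda>x. f x - s x)"
    using intf ints by simp
  also have "\<bar>\<dots>\<bar> \<le> mean (\<lambda>x. \<bar>f x - s x\<bar>)" by (rule integral_abs_bound)
  also have "\<dots> \<le> mean (\<lambda>x. 1 / n + T x)"
    using intf ints intT fs by (intro integral_mono) auto
  also have "\<dots> = 1 / n + mean T" using intT by (simp add: prob_space)
  finally have B: "\<bar>mean f - mean s\<bar> \<le> 1 / n + mean T" .
  have avg_s: "average s m \<omega> = n - (1 / n) * (\<Sum>j<2 * n * n. average (indicator (L j)) m \<omega>)"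
  proof -
    have "(\<Sum>i<m. s (X i \<omega>)) = m * n - (1 / n) * (\<Sum>j<2 * n * n. \<Sum>i<m. indicator (L j) (X i \<omega>))"
      unfolding s_def sum_subtractf sum_distrib_left[symmetric] by (subst sum.swap) simp
    then show ?thesis using \<open>m > 0\<close>
      unfolding sum_distrib_left[symmetric] by (simp add: right_diff_distrib diff_divide_distrib)
  qed
  have mean_s: "mean s = n - (1 / n) * (\<Sum>j<2 * n * n. mean (indicator (L j)))"
    unfolding s_def using intL
    by (subst Bochner_Integration.integral_diff)
      (auto simp: prob_space Bochner_Integration.integral_sum intro!: Bochner_Integration.integrable_sum)
  have "average s m \<omega> - mean s =
      - (1 / n) * (\<Sum>j<2 * n * n. average (indicator (L j)) m \<omega> - mean (indicator (L j)))"
    unfolding avg_s mean_s sum_subtractf by (simp add: right_diff_distrib diff_divide_distrib)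
  also have "\<bar>\<dots>\<bar> \<le> (1 / n) * (\<Sum>j<2 * n * n. \<bar>average (indicator (L j)) m \<omega> - mean (indicator (L j))\<bar>)"
    unfolding abs_mult using sum_abs by (intro mult_mono) auto
  finally show ?thesis using A B by linarith
qed

text \<open>For fixed \<open>n\<close> only finitely many families of sublevel sets and one tail
  function \<open>T n\<close> are involved; the mean of the tail vanishes as \<open>n\<close>
  grows.\<close>

theorem AE_uniform_average:
  fixes \<F> :: "('a \<Rightarrow> real) set" and F :: "'a \<Rightarrow> real"
  assumes "countable \<F>" and meas: "\<And>f. f \<in> \<F> \<Longrightarrow> f \<in> borel_measurable borel"
    and F [measurable]: "F \<in> borel_measurable borel" and F0: "\<And>x. 0 \<le> F x"
    and env: "\<And>f x. f \<in> \<F> \<Longrightarrow> \<bar>f x\<bar> \<le> F x"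
    and vc: "\<And>\<alpha>. \<exists>k. \<not> shatters_card ((\<lambda>f. sublevel f \<alpha>) ` \<F>) k"
    and int: "integrable M (\<lambda>\<omega>. F (X 0 \<omega>))"
  shows "AE \<omega> in M. \<forall>e>0. eventually (\<lambda>m. \<forall>f\<in>\<F>. \<bar>average f m \<omega> - mean f\<bar> \<le> e) sequentially"
proof -
  define T where "T n x = (if F x > real n then F x else 0)" for n x
  have [measurable]: "T n \<in> borel_measurable borel" for n unfolding T_def by measurable
  have intT: "integrable M (\<lambda>\<omega>. T n (X 0 \<omega>))" for n
    by (rule Bochner_Integration.integrable_bound[OF int]) (auto simp: T_def F0)
  have "(\<lambda>n. mean (T n)) \<longlonglongrightarrow> (\<integral>\<omega>. 0 \<partial>M)"
  proof (rule integral_dominated_convergence[OF _ _ int])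
    show "AE \<omega> in M. (\<lambda>n. T n (X 0 \<omega>)) \<longlonglongrightarrow> 0"
    proof (rule AE_I2)
      fix \<omega>
      obtain k :: nat where "F (X 0 \<omega>) \<le> k" using real_arch_simple by blast
      then show "(\<lambda>n. T n (X 0 \<omega>)) \<longlonglongrightarrow> 0"
        by (intro tendsto_eventually) (auto simp: T_def eventually_sequentially intro!: exI[of _ k])
    qed
  qed (auto simp: T_def F0)
  then have T0: "(\<lambda>n. mean (T n)) \<longlonglongrightarrow> 0" by simp
  define L where "L n j f = sublevel f (real j / n - n)" for n j :: nat and f :: "'a \<Rightarrow> real"
  \<comment> \<open>With tolerance \<open>1 / (real n * real n)\<close>, the
    \<open>2 * n * n\<close> levels of weight \<open>1 / n\<close> contribute only
    \<open>2 / n\<close>. Null events are combined over all \<open>n\<close> and \<open>j\<close>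
    before \<open>\<omega>\<close> is fixed.\<close>
  have "AE \<omega> in M. \<forall>n j. n > 0 \<longrightarrow> eventually (\<lambda>m. \<forall>C\<in>L n j ` \<F>.
    \<bar>average (indicator C) m \<omega> - mean (indicator C)\<bar> \<le> 1 / (real n * real n)) sequentially"
    unfolding AE_all_countable
  proof (intro allI)
    fix n j :: nat
    show "AE \<omega> in M. n > 0 \<longrightarrow> eventually (\<lambda>m. \<forall>C\<in>L n j ` \<F>.
      \<bar>average (indicator C) m \<omega> - mean (indicator C)\<bar> \<le> 1 / (real n * real n)) sequentially"
    proof (cases "n > 0")
      case True
      obtain k where k: "\<not> shatters_card (L n j ` \<F>) k"
        using vc[of "real j / n - n"] by (auto simp: L_def)
      have "L n j f \<in> sets borel" if "f \<in> \<F>" for f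
        using meas[OF that] unfolding L_def sublevel_def by simp
      then have "AE \<omega> in M. eventually (\<lambda>m. \<forall>C\<in>L n j ` \<F>.
          \<bar>average (indicator C) m \<omega> - mean (indicator C)\<bar> \<le> 1 / (real n * real n)) sequentially"
        using True \<open>countable \<F>\<close> by (intro AE_eventually_close_on_sets[OF _ _ k]) auto
      then show ?thesis by simp
    qed simp
  qed
  moreover have "AE \<omega> in M. \<forall>n. (\<lambda>m. average (T n) m \<omega>) \<longlonglongrightarrow> mean (T n)"
    unfolding AE_all_countable using intT by (intro allI ergodic_average) auto
  ultimately show ?thesis
  proof eventually_elim
    case (elim \<omega>)
    \<comment> \<open>The \<open>5 / n\<close> consists of \<open>2 / n\<close> from rounding,
      \<open>2 / n\<close> from the levels and \<open>1 / n\<close> from the tail average, which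
      also brings a second \<open>mean (T n)\<close>.\<close>
    have bound: "eventually (\<lambda>m. \<forall>f\<in>\<F>. \<bar>average f m \<omega> - mean f\<bar> \<le> 5 / n + 2 * mean (T n)) sequentially"
      if "n > 0" for n :: nat
    proof -
      have "eventually (\<lambda>m. \<forall>j\<in>{..<2 * n * n}. \<forall>C\<in>L n j ` \<F>.
          \<bar>average (indicator C) m \<omega> - mean (indicator C)\<bar> \<le> 1 / (real n * real n)) sequentially"
        using elim(1) that by (intro eventually_ball_finite) auto
      moreover have "eventually (\<lambda>m. dist (average (T n) m \<omega>) (mean (T n)) < 1 / n) sequentially"
        using elim(2) that by (intro tendstoD) auto
      ultimately show ?thesis
        using eventually_gt_at_top[of 0]
      proof eventually_elim
        case (elim m)
        show ?case
        proof
          fix f assume f: "f \<in> \<F>"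
          have "(\<Sum>j<2 * n * n. \<bar>average (indicator (L n j f)) m \<omega> - mean (indicator (L n j f))\<bar>)
              \<le> (\<Sum>j<2 * n * n. 1 / (real n * real n))"
            using elim(1) f by (intro sum_mono) blast
          also have "\<dots> = 2" using that by simp
          finally have "(1 / n) * (\<Sum>j<2 * n * n. \<bar>average (indicator (L n j f)) m \<omega> - mean (indicator (L n j f))\<bar>)
              \<le> (1 / n) * 2" by (intro mult_left_mono) auto
          moreover have "average (T n) m \<omega> \<le> mean (T n) + 1 / n"
            using elim(2) by (simp add: dist_real_def)
          moreover have "\<bar>average f m \<omega> - mean f\<bar> \<le> 2 / n + average (T n) m \<omega> + mean (T n) +
             (1 / n) * (\<Sum>j<2 * n * n. \<bar>average (indicator (L n j f)) m \<omega> - mean (indicator (L n j f))\<bar>)"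
            unfolding T_def L_def
            by (rule average_minus_mean_le_levels[OF meas[OF f] F env[OF f] int that elim(3)])
          moreover have "5 / real n = 2 / n + 1 / n + (1 / n) * 2" using that by (simp add: field_simps)
          ultimately show "\<bar>average f m \<omega> - mean f\<bar> \<le> 5 / n + 2 * mean (T n)" by linarith
        qed
      qed
    qed
    show ?case
    proof (intro allI impI)
      fix e :: real assume "e > 0"
      have "(\<lambda>n. 5 / n + 2 * mean (T n)) \<longlonglongrightarrow> 0 + 2 * 0"
        by (intro tendsto_intros T0 lim_const_over_n)
      then have "eventually (\<lambda>n. 5 / n + 2 * mean (T n) < e) sequentially"
        using \<open>e > 0\<close> by (intro order_tendstoD) auto
      then obtain n where n: "n > 0" "5 / n + 2 * mean (T n) < e"
        using eventually_gt_at_top[of 0] eventually_happens'[OF sequentially_bot eventually_conj] by blast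
      from bound[OF n(1)] show "eventually (\<lambda>m. \<forall>f\<in>\<F>. \<bar>average f m \<omega> - mean f\<bar> \<le> e) sequentially"
        by eventually_elim (use n(2) in force)
    qed
  qed
qed

end

section \<open>VC-major classes and convergence of the supremum\<close>

lemma vc_major_not_shatters:
  assumes "vc_major \<F>"
  shows "\<exists>k. \<not> shatters_card ((\<lambda>f. sublevel f \<alpha>) ` \<F>) k"
proof -
  have "vc_dim ((\<lambda>f. sublevel f \<alpha>) ` \<F>) \<le> (SUP \<alpha>. vc_dim ((\<lambda>f. sublevel f \<alpha>) ` \<F>))"
    by (rule SUP_upper) simp
  with assms have "vc_dim ((\<lambda>f. sublevel f \<alpha>) ` \<F>) \<noteq> \<infinity>"
    unfolding vc_major_def by (metis leD)
  then show ?thesis by (auto simp: vc_dim_eq_infinity_iff)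
qed

lemma tendsto_SUP_ennreal_zeroI:
  fixes d :: "nat \<Rightarrow> 'b \<Rightarrow> real"
  assumes "\<And>e. e > 0 \<Longrightarrow> eventually (\<lambda>m. \<forall>f\<in>\<F>. d m f \<le> e) sequentially"
  shows "(\<lambda>m. SUP f\<in>\<F>. ennreal (d m f)) \<longlonglongrightarrow> 0"
proof (rule order_tendstoI)
  fix a :: ennreal assume "0 < a"
  \<comment> \<open>The supremum of values at most \<open>b\<close> may equal \<open>b\<close>, so
    \<open>b\<close> is chosen strictly below \<open>a\<close>.\<close>
  then obtain b where b: "0 < b" "b < a" using dense by blast
  then have "b \<noteq> \<top>" using less_top_ennreal by fastforce
  then have e: "ennreal (enn2real b) = b" "enn2real b > 0"
    using b by (auto simp: enn2real_positive_iff top.not_eq_extremum)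
  from assms[OF e(2)] show "eventually (\<lambda>m. (SUP f\<in>\<F>. ennreal (d m f)) < a) sequentially"
  proof eventually_elim
    case (elim m)
    then have "(SUP f\<in>\<F>. ennreal (d m f)) \<le> ennreal (enn2real b)"
      by (intro SUP_least ennreal_leI) auto
    then show ?case using e b by simp
  qed
qed simp

text \<open>The supremum is formed in \<open>ennreal\<close>, where it exists without a boundedness
  condition and is \<open>0\<close> for an empty family.\<close>

theorem proposition1:
  fixes \<F> :: "('a::polish_space \<Rightarrow> real) set"
    and F :: "'a \<Rightarrow> real"
    and M :: "'w measure"
    and X :: "nat \<Rightarrow> 'w \<Rightarrow> 'a"
  assumes "countable \<F>"
    and "\<And>f. f \<in> \<F> \<Longrightarrow> f \<in> borel_measurable borel"
    and "is_envelope F \<F>"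
    and "vc_major \<F>"
    and "random_process M X"
    and "stationary M X"
    and "ergodic M X"
    and "integrable M (\<lambda>\<omega>. F (X 0 \<omega>))"
  shows "AE \<omega> in M.
    (\<lambda>m. SUP f\<in>\<F>. ennreal \<bar>(1 / real m) * (\<Sum>i<m. f (X i \<omega>)) - (\<integral>\<omega>'. f (X 0 \<omega>') \<partial>M)\<bar>)
      \<longlonglongrightarrow> 0"
proof -
  interpret ergodic_process M X
    using assms(5-7)
    by (auto simp: random_process_def ergodic_process_def ergodic_process_axioms_def)
  have "AE \<omega> in M. \<forall>e>0. eventually (\<lambda>m. \<forall>f\<in>\<F>. \<bar>average f m \<omega> - mean f\<bar> \<le> e) sequentially"
    using assms(1-3,8) vc_major_not_shatters[OF assms(4)]
    by (intro AE_uniform_average[of _ F]) (auto simp: is_envelope_def)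
  then show ?thesis
    by eventually_elim (intro tendsto_SUP_ennreal_zeroI; blast)
qed

end
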